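(* Let $\mathcal{C}\subseteq\mathbb{R}^d$ be a polytope of diameter $\delta>0$ and pyramidal width $\omega>0$ and let $f\colon\mathcal{C}\to\mathbb{R}$ be a convex and $L$-smooth function satisfying a $(\mu,\theta)$-Hölderian error bound for some $\mu>0$ and $\theta\in[0,1/2]$ with unique minimizer $x^*\in\operatorname{argmin}_{x\in\mathcal{C}}f(x)$. Let $T\in\mathbb{N}$ and $\eta_t=\frac{4}{t+4}$ for all $t\in\mathbb{Z}$. Then, for the iterates $x_t$ of the away-step Frank-Wolfe algorithm with open-loop step-sizes (AFW) with step-size $\eta_t$, with $h_t=f(x_t)-f(x^* )$, it holds that $$h_t\le\max\left\{\eta_{\lceil t/2-2\rceil}^{1/(1-\theta)}\frac{L\delta^2}{2},\ \left(\frac{\eta_{\lceil t/2-2\rceil}\,2\mu L\delta^2}{\omega}\right)^{1/(1-\theta)}+\eta_{\lceil t/2-2\rceil}^2\frac{L\delta^2}{2}\right\}$$ for all $t\in\{1,\ldots,T\}$.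
   Context: AFW with open-loop step-sizes: given $x_0\in\operatorname{vert}(\mathcal{C})$ (the vertices of $\mathcal{C}$) and step-sizes $\eta_t\in[0,1]$, set $\mathcal{S}_0=\{x_0\}$, $\lambda_{x_0,0}=1$, $\lambda_{p,0}=0$ for all other $p\in\operatorname{vert}(\mathcal{C})$, and $\ell_0=0$. For $t=0,\ldots,T-1$: (1) let $p_t^{FW}\in\operatorname{argmin}_{p\in\mathcal{C}}\langle\nabla f(x_t),p-x_t\rangle$ (a vertex of $\mathcal{C}$) and $p_t^A\in\operatorname{argmax}_{p\in\mathcal{S}_t}\langle\nabla f(x_t),p-x_t\rangle$; (2) if $\langle\nabla f(x_t),p_t^{FW}-x_t\rangle\le\langle\nabla f(x_t),x_t-p_t^A\rangle$, set $d_t=p_t^{FW}-x_t$ and $\eta_{t,\max}=1$; otherwise set $d_t=x_t-p_t^A$ and $\eta_{t,\max}=\frac{\lambda_{p_t^A,t}}{1-\lambda_{p_t^A,t}}$; (3) set $\gamma_t=\min\{\eta_{\ell_t},\eta_{t,\max}\}$ and $x_{t+1}=x_t+\gamma_td_t$; (4) in the first case of (2), set $\lambda_{p,t+1}=(1-\gamma_t)\lambda_{p,t}+\gamma_t$ for $p=p_t^{FW}$ and $\lambda_{p,t+1}=(1-\gamma_t)\lambda_{p,t}$ for all other vertices $p$; in the second case, set $\lambda_{p,t+1}=(1+\gamma_t)\lambda_{p,t}-\gamma_t$ for $p=p_t^A$ and $\lambda_{p,t+1}=(1+\gamma_t)\lambda_{p,t}$ for all other vertices $p$; (5) set $\mathcal{S}_{t+1}=\{p\in\operatorname{vert}(\mathcal{C})\mid\lambda_{p,t+1}>0\}$;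 (6) if $(\eta_{\ell_t}-\gamma_t)\langle\nabla f(x_t),p_t^A-p_t^{FW}\rangle\le(\eta_{\ell_t}^2-\gamma_t^2)L\delta^2$, set $\ell_{t+1}=\ell_t+1$ (progress step); otherwise set $\ell_{t+1}=\ell_t$. Pyramidal width (Lacoste-Julien and Jaggi): let $V=\operatorname{vert}(\mathcal{C})$. For a finite set $A\subseteq\mathbb{R}^d$, $x\in\operatorname{conv}(A)$, and $r\ne0$, let $\mathrm{PdirW}(A,r,x)=\min_{Q\in\mathcal{Q}_x}\max_{s\in A,\,v\in Q}\left\langle\frac{r}{\|r\|_2},s-v\right\rangle$, where $\mathcal{Q}_x$ is the collection of subsets $Q\subseteq A$ such that $x$ is a convex combination of the elements of $Q$ with all coefficients strictly positive. The pyramidal width of $\mathcal{C}$ is the minimum of $\mathrm{PdirW}(K\cap V,r,x)$ over all nonempty faces $K$ of $\mathcal{C}$, all $x\in K$, and all $r\in\operatorname{cone}(K-x)\setminus\{0\}$. $L$-smooth ($L>0$): $f$ is differentiable in an open set containing $\mathcal{C}$ and $f(y)\le f(x)+\langle\nabla f(x),y-x\rangle+\frac{L}{2}\|x-y\|_2^2$ for all $x,y\in\mathcal{C}$. $(\mu,\theta)$-Hölderian error bound (with unique minimizer $x^*$ of $f$ over $\mathcal{C}$): $\mu(f(x)-f(x^* ))^\theta\ge\|x-x^*\|_2$ for all $x\in\mathcal{C}$. The diameter is with respect to $\|\cdot\|_2$. *)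

theory Defs
  imports "HOL-Analysis.Analysis"
begin

definition vert :: "'a::euclidean_space set \<Rightarrow> 'a set" where
  "vert C = {p. p extreme_point_of C}"

definition grad :: "('a::euclidean_space \<Rightarrow> real) \<Rightarrow> 'a \<Rightarrow> 'a" where
  "grad f x = (THE D. GDERIV f x :> D)"

lemma grad_eqI:
  assumes "GDERIV f x :> D"
  shows "grad f x = D"
  unfolding grad_def
proof (rule the_equality)
  fix D' assume "GDERIV f x :> D'"
  then have "(\<lambda>h. h \<bullet> D') = (\<lambda>h. h \<bullet> D)"
    using assms unfolding gderiv_def by (rule has_derivative_unique)
  from fun_cong[OF this] have "\<forall>z. z \<bullet> D' = z \<bullet> D"
    by (rule allI)
  then show "D' = D"
    by (simp only: vector_eq_ldot)
qed (fact assms)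

lemma GDERIV_grad:
  assumes "f differentiable (at x)"
  shows "GDERIV f x :> grad f x"
proof -
  obtain f' where f': "(f has_derivative f') (at x)"
    using assms by (auto simp: differentiable_def)
  have "f' h = h \<bullet> adjoint f' 1" for h
    using adjoint_works[OF has_derivative_linear[OF f'], of h 1] by (simp only: inner_real_def mult_1_right)
  then obtain D where "f' = (\<lambda>h. h \<bullet> D)"
    by blast
  with f' have "GDERIV f x :> D"
    by (simp only: gderiv_def)
  then show ?thesis
    by (simp add: grad_eqI)
qed

text \<open>The function \<open>f\<close> is total on the ambient type; only its values on the open set \<open>U\<close>,
  and in particular on \<open>C\<close>, are constrained.\<close>

definition L_smooth_on :: "'a::euclidean_space set \<Rightarrow> ('a \<Rightarrow> real) \<Rightarrow> real \<Rightarrow> bool" where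
  "L_smooth_on C f L \<longleftrightarrow>
     0 < L \<and>
     (\<exists>U. open U \<and> C \<subseteq> U \<and> (\<forall>x\<in>U. f differentiable (at x))) \<and>
     (\<forall>x\<in>C. \<forall>y\<in>C. f y \<le> f x + grad f x \<bullet> (y - x) + L / 2 * (norm (x - y))\<^sup>2)"

text \<open>Here \<open>xs\<close> is the unique minimizer of \<open>f\<close> over \<open>C\<close>, so the convention \<open>0 powr 0 = 0\<close> only
  matters at \<open>x = xs\<close>, where the inequality holds for every value of \<open>0 powr 0\<close> in \<open>[0, 1]\<close>.\<close>

definition holder_error_bound ::
    "'a::euclidean_space set \<Rightarrow> ('a \<Rightarrow> real) \<Rightarrow> 'a \<Rightarrow> real \<Rightarrow> real \<Rightarrow> bool" where
  "holder_error_bound C f xs \<mu> \<theta> \<longleftrightarrow>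
     (\<forall>x\<in>C. norm (x - xs) \<le> \<mu> * (f x - f xs) powr \<theta>)"

definition strict_supports :: "'a::euclidean_space set \<Rightarrow> 'a \<Rightarrow> 'a set set" where
  "strict_supports A x =
     {Q. Q \<subseteq> A \<and> (\<exists>u. (\<forall>v\<in>Q. 0 < u v) \<and> sum u Q = 1 \<and> (\<Sum>v\<in>Q. u v *\<^sub>R v) = x)}"

text \<open>Meaningful for finite \<open>A\<close>, \<open>x \<in> convex hull A\<close> and \<open>r \<noteq> 0\<close>; then both extrema range over
  finite nonempty sets.\<close>

definition PdirW :: "'a::euclidean_space set \<Rightarrow> 'a \<Rightarrow> 'a \<Rightarrow> real" where
  "PdirW A r x =
     Min ((\<lambda>Q. Max ((\<lambda>(s, v). (r /\<^sub>R norm r) \<bullet> (s - v)) ` (A \<times> Q))) ` strict_supports A x)"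

text \<open>The minimum over the (in general infinite) family is written as an infimum; the two agree
  as soon as the minimum exists. For a polytope \<open>C\<close> all members of the family are nonnegative, and
  the family is nonempty when \<open>C\<close> has at least two points.\<close>

definition pyramidal_width :: "'a::euclidean_space set \<Rightarrow> real" where
  "pyramidal_width C =
     Inf {PdirW (K \<inter> vert C) r x | K r x.
            K face_of C \<and> K \<noteq> {} \<and> x \<in> K \<and> r \<in> cone hull ((\<lambda>y. y - x) ` K) - {0}}"

text \<open>\<open>x\<close> is a sequence of iterates of the away-step Frank--Wolfe algorithm with open-loop
  step-sizes, run for \<open>T\<close> iterations, for some admissible choice of \<open>pF t\<close> and \<open>pA t\<close> in the argmin
  and argmax. Entries beyond index \<open>T\<close> are unconstrained. The step-size sequence is
  indexed by the integers, although the algorithm only uses nonnegative indices.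

  The quotient in the away case never has denominator zero: if \<open>lam t (pA t) = 1\<close>, then
  \<open>x t = pA t\<close>, so the right-hand side of the test is \<open>0\<close> and the Frank--Wolfe case is taken.\<close>

definition afw_iterates ::
    "'a::euclidean_space set \<Rightarrow> ('a \<Rightarrow> real) \<Rightarrow> real \<Rightarrow> (int \<Rightarrow> real) \<Rightarrow> nat \<Rightarrow> (nat \<Rightarrow> 'a) \<Rightarrow> bool" where
  "afw_iterates C f L \<eta> T x \<longleftrightarrow>
     (\<forall>k::nat. \<eta> (int k) \<in> {0..1}) \<and>
     (\<exists>(pF :: nat \<Rightarrow> 'a) (pA :: nat \<Rightarrow> 'a) (S :: nat \<Rightarrow> 'a set) (lam :: nat \<Rightarrow> 'a \<Rightarrow> real)
        (l :: nat \<Rightarrow> nat) (d :: nat \<Rightarrow> 'a) (\<eta>max :: nat \<Rightarrow> real) (\<gamma> :: nat \<Rightarrow> real).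
        x 0 \<in> vert C \<and> S 0 = {x 0} \<and> lam 0 (x 0) = 1 \<and>
        (\<forall>p \<in> vert C - {x 0}. lam 0 p = 0) \<and> l 0 = 0 \<and>
        (\<forall>t<T.
           pF t \<in> vert C \<and>
           is_arg_min (\<lambda>p. grad f (x t) \<bullet> (p - x t)) (\<lambda>p. p \<in> C) (pF t) \<and>
           is_arg_max (\<lambda>p. grad f (x t) \<bullet> (p - x t)) (\<lambda>p. p \<in> S t) (pA t) \<and>
           \<gamma> t = min (\<eta> (int (l t))) (\<eta>max t) \<and>
           x (Suc t) = x t + \<gamma> t *\<^sub>R d t \<and>
           (if grad f (x t) \<bullet> (pF t - x t) \<le> grad f (x t) \<bullet> (x t - pA t)
            then d t = pF t - x t \<and> \<eta>max t = 1 \<and>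
                 lam (Suc t) (pF t) = (1 - \<gamma> t) * lam t (pF t) + \<gamma> t \<and>
                 (\<forall>p \<in> vert C - {pF t}. lam (Suc t) p = (1 - \<gamma> t) * lam t p)
            else d t = x t - pA t \<and> \<eta>max t = lam t (pA t) / (1 - lam t (pA t)) \<and>
                 lam (Suc t) (pA t) = (1 + \<gamma> t) * lam t (pA t) - \<gamma> t \<and>
                 (\<forall>p \<in> vert C - {pA t}. lam (Suc t) p = (1 + \<gamma> t) * lam t p)) \<and>
           S (Suc t) = {p \<in> vert C. 0 < lam (Suc t) p} \<and>
           l (Suc t) =
             (if (\<eta> (int (l t)) - \<gamma> t) * (grad f (x t) \<bullet> (pA t - pF t))
                   \<le> ((\<eta> (int (l t)))\<^sup>2 - (\<gamma> t)\<^sup>2) * L * (diameter C)\<^sup>2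
              then l t + 1 else l t)))"

end

theory Submission
  imports Defs
begin

text \<open>The away-step gap \<open>g = \<nabla>f(x) \<bullet> (p\<^sup>A - p\<^sup>F\<^sup>W)\<close> dominates \<open>\<omega> \<nabla>f(x) \<bullet> (x - x\<^sup>*) / \<parallel>x - x\<^sup>*\<parallel>\<close> and
  hence, by convexity and the error bound, \<open>(\<omega> / \<mu>) h\<^bsup>1 - \<theta>\<^esup>\<close>. The chosen direction
  decreases \<open>f\<close> at rate at least \<open>max h (g / 2) \<ge> h / 2 + g / 4\<close>. In a progress step with index
  \<open>l\<close> and \<open>M = L \<delta>\<^sup>2 / 2\<close>, either \<open>g \<le> 4 \<eta>\<^sub>l M\<close>, so that \<open>h\<close> is already small and grows by at most
  \<open>\<eta>\<^sub>l\<^sup>2 M\<close>, or the step is not truncated and \<open>h\<close> shrinks by the factor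
  \<open>1 - \<eta>\<^sub>l / 2\<close>. The other steps do not increase \<open>h\<close> and drop a vertex from the active set, so at
  least half of all steps are progress steps.\<close>

section \<open>Convexity and projection onto cones\<close>

lemma convex_gradient_inequality:
  assumes f: "convex_on C f" and d: "f differentiable (at x)" and x: "x \<in> C" and y: "y \<in> C"
  shows "f x + grad f x \<bullet> (y - x) \<le> f y"
proof -
  define g where "g = (\<lambda>s. f (x + s *\<^sub>R (y - x)))"
  have "(f has_derivative (\<lambda>h. h \<bullet> grad f x)) (at (x + 0 *\<^sub>R (y - x)))"
    using GDERIV_grad[OF d] by (simp add: gderiv_def)
  then have "(g has_derivative (\<lambda>s. (s *\<^sub>R (y - x)) \<bullet> grad f x)) (at 0)"
    unfolding g_def by (rule has_derivative_compose[rotated]) (auto intro!: derivative_eq_intros)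
  then have "(g has_real_derivative (grad f x \<bullet> (y - x))) (at 0)"
    by (simp add: has_field_derivative_def inner_commute mult.commute[of _ "grad f x \<bullet> (y - x)"]
      fun_eq_iff)
  \<comment> \<open>Convexity controls \<open>g\<close> only between 0 and 1, so the derivative at 0
    is taken as a right-hand limit of difference quotients, each at most
    \<open>f y - f x\<close>.\<close>
  then have lim: "((\<lambda>s. (g s - g 0) / s) \<longlongrightarrow> grad f x \<bullet> (y - x)) (at_right 0)"
    by (simp add: has_field_derivative_iff filterlim_at_split)
  have le: "(g s - g 0) / s \<le> f y - f x" if s: "0 < s" "s < 1" for s
  proof -
    have "g s = f ((1 - s) *\<^sub>R x + s *\<^sub>R y)"
      by (simp add: g_def algebra_simps)
    also have "\<dots> \<le> (1 - s) * f x + s * f y"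
      using s f x y by (auto intro!: convex_onD)
    finally show ?thesis
      using s by (simp add: g_def field_simps)
  qed
  have "grad f x \<bullet> (y - x) \<le> f y - f x"
  proof (rule tendsto_upperbound[OF lim])
    show "\<forall>\<^sub>F s in at_right 0. (g s - g 0) / s \<le> f y - f x"
      unfolding eventually_at_right_field using le by (intro exI[of _ 1]) auto
  qed simp
  then show ?thesis by simp
qed

lemma cone_hull_eq_conic_hull: "cone hull S = conic hull S"
  by (rule arg_cong[where f = "\<lambda>P. P hull S"]) (auto simp: cone_def conic_def fun_eq_iff)

lemma moreau_decomposition:
  fixes K :: "'a::euclidean_space set"
  assumes "convex K" "closed K" "conic K" "K \<noteq> {}"
  obtains p where "p \<in> K" "(r - p) \<bullet> p = 0" "\<And>e. e \<in> K \<Longrightarrow> (r - p) \<bullet> e \<le> 0"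
proof
  let ?p = "closest_point K r"
  show p: "?p \<in> K"
    using assms by (auto intro: closest_point_in_set)
  have dot: "(r - ?p) \<bullet> (e - ?p) \<le> 0" if "e \<in> K" for e
    using closest_point_dot assms that by blast
  \<comment> \<open>Testing the obtuse-angle inequality at twice the projection and at 0 gives the
    same inner product with both signs, hence orthogonality.\<close>
  have "2 *\<^sub>R ?p \<in> K" "0 *\<^sub>R ?p \<in> K"
    using p \<open>conic K\<close> by (auto simp: conic_def simp del: scaleR_zero_left)
  from this[THEN dot] show orth: "(r - ?p) \<bullet> ?p = 0"
    by (simp add: inner_diff_left inner_diff_right scaleR_2 inner_add_right)
  show "(r - ?p) \<bullet> e \<le> 0" if "e \<in> K" for e
    using dot[OF that] orth by (simp add: inner_diff_right)
qed

section \<open>Pyramidal width\<close>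

lemma finite_vert: "polytope C \<Longrightarrow> finite (vert C)"
  unfolding vert_def by (simp add: finite_polyhedron_extreme_points polytope_imp_polyhedron)

lemma strict_supports_subset_Pow: "strict_supports A x \<subseteq> Pow A"
  by (auto simp: strict_supports_def)

text \<open>The extrema must be seen to range over nonempty sets. Dropping the zero weights from a
  convex representation of \<open>x\<close> gives a member of \<open>strict_supports A x\<close>,
  and a pair \<open>(v, v)\<close> with \<open>v \<in> Q\<close> contributes the value 0 to each
  maximum.\<close>

lemma PdirW_nonneg:
  assumes "finite A" "x \<in> convex hull A"
  shows "0 \<le> PdirW A r x"
proof -
  have fin: "finite (strict_supports A x)"
    using strict_supports_subset_Pow by (rule finite_subset) (use assms in simp)
  obtain S u where S: "finite S" "S \<subseteq> A" "\<forall>v\<in>S. 0 \<le> u v" "sum u S = 1" "(\<Sum>v\<in>S. u v *\<^sub>R v) = x"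
    using assms(2) unfolding convex_hull_explicit by blast
  let ?Q = "{v \<in> S. u v \<noteq> 0}"
  have "sum u ?Q = 1" "(\<Sum>v\<in>?Q. u v *\<^sub>R v) = x"
    using S by (auto intro!: sum.mono_neutral_left
        simp: sum.mono_neutral_left[of S ?Q u] sum.mono_neutral_left[of S ?Q "\<lambda>v. u v *\<^sub>R v"])
  then have "?Q \<in> strict_supports A x"
    using S by (auto simp: strict_supports_def intro!: exI[of _ u] order.not_eq_order_implies_strict)
  moreover have "0 \<le> Max ((\<lambda>(s, v). (r /\<^sub>R norm r) \<bullet> (s - v)) ` (A \<times> Q))"
    if Q: "Q \<in> strict_supports A x" for Q
  proof -
    from Q have "Q \<subseteq> A" "Q \<noteq> {}"
      by (auto simp: strict_supports_def)
    then obtain v where v: "v \<in> A" "v \<in> Q" by blast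
    have "finite (A \<times> Q)"
      using assms \<open>Q \<subseteq> A\<close> finite_subset by blast
    moreover have "(\<lambda>(s, v). (r /\<^sub>R norm r) \<bullet> (s - v)) (v, v) = 0"
      by simp
    then have "0 \<in> (\<lambda>(s, v). (r /\<^sub>R norm r) \<bullet> (s - v)) ` (A \<times> Q)"
      using v by (metis (no_types, lifting) SigmaI image_eqI)
    ultimately show ?thesis
      by (intro Max_ge) auto
  qed
  ultimately show ?thesis
    unfolding PdirW_def using fin by (subst Min_ge_iff) auto
qed

lemma face_of_vert: "K face_of C \<Longrightarrow> K \<inter> vert C = {p. p extreme_point_of K}"
  by (auto simp: vert_def extreme_point_of_face)

text \<open>The real \<open>Inf\<close> is a lower bound only for a family bounded below. The bound
  0 comes from \<open>PdirW_nonneg\<close>, as each face of a polytope is the convex hull of its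
  vertices.\<close>

lemma pyramidal_width_le:
  assumes C: "polytope C" and K: "K face_of C" "x \<in> K" "r \<in> cone hull ((\<lambda>y. y - x) ` K)" "r \<noteq> 0"
  shows "pyramidal_width C \<le> PdirW (K \<inter> vert C) r x"
  unfolding pyramidal_width_def
proof (rule cInf_lower)
  have "0 \<le> PdirW (K \<inter> vert C) r x" if "K face_of C" "x \<in> K" for K r x
  proof (rule PdirW_nonneg)
    show "finite (K \<inter> vert C)"
      using finite_vert[OF C] by simp
    have "polytope K"
      using face_of_polytope_polytope[OF C] that by blast
    then have "K = convex hull {p. p extreme_point_of K}"
      by (intro Krein_Milman_Minkowski polytope_imp_compact polytope_imp_convex)
    with that show "x \<in> convex hull (K \<inter> vert C)"
      by (simp add: face_of_vert)
  qed
  then show "bdd_below {PdirW (K \<inter> vert C) r x | K r x.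
      K face_of C \<and> K \<noteq> {} \<and> x \<in> K \<and> r \<in> cone hull ((\<lambda>y. y - x) ` K) - {0}}"
    by (intro bdd_belowI[of _ 0]) blast
qed (use K in blast)

text \<open>Any single \<open>Q\<close> bounds the minimum, and the maximum for that
  \<open>Q\<close> is attained. Multiplying by \<open>norm r\<close> removes the normalization of
  the direction.\<close>

lemma PdirW_le_Max:
  assumes "finite A" "Q \<in> strict_supports A x" "A \<noteq> {}"
  obtains s v where "s \<in> A" "v \<in> Q" "norm r * PdirW A r x \<le> r \<bullet> (s - v)"
proof -
  let ?h = "\<lambda>(s, v). (r /\<^sub>R norm r) \<bullet> (s - v)"
  have Q: "Q \<subseteq> A" "Q \<noteq> {}" using assms by (auto simp: strict_supports_def)
  have "finite (strict_supports A x)"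
    using strict_supports_subset_Pow by (rule finite_subset) (use assms in simp)
  then have "PdirW A r x \<le> Max (?h ` (A \<times> Q))"
    unfolding PdirW_def using assms by (intro Min_le) auto
  moreover have "Max (?h ` (A \<times> Q)) \<in> ?h ` (A \<times> Q)"
    using assms Q by (intro Max_in) (auto intro: finite_subset)
  then obtain s v where sv: "s \<in> A" "v \<in> Q" "Max (?h ` (A \<times> Q)) = (r /\<^sub>R norm r) \<bullet> (s - v)"
    by auto
  ultimately have "norm r * PdirW A r x \<le> norm r * ((r /\<^sub>R norm r) \<bullet> (s - v))"
    by (intro mult_left_mono) auto
  also have "\<dots> = r \<bullet> (s - v)"
    by (cases "r = 0") auto
  finally show ?thesis using sv that by blast
qed

text \<open>Write \<open>- g = r + n\<close> with \<open>r\<close> the projection onto the cone of feasible directions at \<open>x\<close>. The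
  normal part \<open>n\<close> exposes a face containing \<open>x\<close>, the support of \<open>x\<close> and \<open>x + \<epsilon> r\<close>; on that face
  \<open>- g\<close> and \<open>r\<close> induce the same functional up to a constant, so the pyramidal width applies to \<open>r\<close>.\<close>

lemma pyramidal_width_scaling:
  fixes C :: "'a::euclidean_space set"
  assumes C: "polytope C"
    and Q: "Q \<subseteq> vert C" "\<And>v. v \<in> Q \<Longrightarrow> 0 < u v" "sum u Q = 1" "(\<Sum>v\<in>Q. u v *\<^sub>R v) = x"
    and x: "x \<in> C" and y: "y \<in> C"
    and pF: "\<And>p. p \<in> C \<Longrightarrow> g \<bullet> pF \<le> g \<bullet> p"
    and pA: "\<And>p. p \<in> Q \<Longrightarrow> g \<bullet> p \<le> g \<bullet> pA"
    and w: "0 \<le> pyramidal_width C"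
    and pos: "0 < g \<bullet> (x - y)"
  shows "pyramidal_width C * (g \<bullet> (x - y)) \<le> norm (x - y) * (g \<bullet> (pA - pF))"
proof -
  let ?D = "(\<lambda>y. y - x) ` C"
  have cC: "convex C" using C by (rule polytope_imp_convex)
  have vC: "vert C \<subseteq> C" by (auto simp: vert_def extreme_point_of_def)
  have pD: "polytope ?D"
    using polytope_translation_eq[of "-x" C] C by simp
  obtain r where r: "r \<in> conic hull ?D" "(- g - r) \<bullet> r = 0"
    and polar: "\<And>e. e \<in> conic hull ?D \<Longrightarrow> (- g - r) \<bullet> e \<le> 0"
  proof (rule moreau_decomposition[of "conic hull ?D" "- g"])
    show "convex (conic hull ?D)"
      by (intro convex_conic_hull polytope_imp_convex pD)
    show "closed (conic hull ?D)"
      using pD by (simp add: polyhedron_conic_hull_polytope polyhedron_imp_closed)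
  qed (use x in \<open>auto simp: conic_conic_hull conic_hull_eq_empty\<close>)
  define n where "n = - g - r"
  have n: "n \<bullet> (z - x) \<le> 0" if "z \<in> C" for z
    unfolding n_def using that by (intro polar hull_inc) auto
  define F where "F = C \<inter> {z. n \<bullet> z = n \<bullet> x}"
  have F: "F face_of C"
    unfolding F_def using n cC
    by (intro face_of_Int_supporting_hyperplane_le) (auto simp: inner_diff_right)
  have xF: "x \<in> F" using x by (simp add: F_def)
  \<comment> \<open>\<open>x\<close> maximizes \<open>n\<close> over \<open>C\<close> and is a
    combination of \<open>Q\<close> with positive weights, so every point of \<open>Q\<close>
    attains that maximum.\<close>
  have QF: "Q \<subseteq> F"
  proof
    fix v assume v: "v \<in> Q"
    have fQ: "finite Q" using Q(1) finite_vert[OF C] finite_subset by blast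
    have "(\<Sum>v\<in>Q. u v * (n \<bullet> (x - v))) = n \<bullet> ((sum u Q) *\<^sub>R x - (\<Sum>v\<in>Q. u v *\<^sub>R v))"
      by (simp add: inner_diff_right inner_sum_right right_diff_distrib sum_subtractf sum_distrib_right)
    also have "\<dots> = 0" using Q by simp
    finally have sum0: "(\<Sum>v\<in>Q. u v * (n \<bullet> (x - v))) = 0" .
    have "0 \<le> u v * (n \<bullet> (x - v))" if "v \<in> Q" for v
      using n[of v] Q vC that by (intro mult_nonneg_nonneg) (auto simp: inner_diff_right less_imp_le)
    then have "u v * (n \<bullet> (x - v)) = 0"
      using sum0 v fQ by (simp add: sum_nonneg_eq_0_iff)
    then show "v \<in> F" using Q v vC by (force simp: F_def inner_diff_right)
  qed
  have r_le: "g \<bullet> (x - y) \<le> r \<bullet> (y - x)"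
    using n[OF y] by (simp add: n_def inner_diff_right inner_diff_left)
  then have r0: "r \<noteq> 0" using pos by auto
  \<comment> \<open>As a nonzero element of the cone, \<open>r\<close> is a positive multiple of
    some \<open>z - x\<close>. Orthogonality of \<open>n\<close> and \<open>r\<close> then places
    \<open>z\<close> in \<open>F\<close>, so \<open>r\<close> is a feasible direction of that
    face.\<close>
  obtain c z where cz: "0 \<le> c" "z \<in> C" "r = c *\<^sub>R (z - x)"
    using r(1) by (auto simp: conic_hull_explicit)
  with r0 have "c \<noteq> 0" by auto
  with r(2) cz have "n \<bullet> (z - x) = 0" by (simp add: n_def)
  then have "z \<in> F" using cz by (simp add: F_def inner_diff_right)
  then have rF: "r \<in> cone hull ((\<lambda>y. y - x) ` F)"
    using cz by (auto simp: cone_hull_eq_conic_hull conic_hull_explicit)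
  have "Q \<in> strict_supports (F \<inter> vert C) x"
    using Q QF by (auto simp: strict_supports_def)
  moreover have "F \<inter> vert C \<noteq> {}"
    using QF Q(1,3) by (cases "Q = {}") auto
  ultimately obtain s v where sv: "s \<in> F \<inter> vert C" "v \<in> Q"
      "norm r * PdirW (F \<inter> vert C) r x \<le> r \<bullet> (s - v)"
    using PdirW_le_Max[of "F \<inter> vert C"] finite_vert[OF C] by blast
  \<comment> \<open>Cauchy-Schwarz brings in the factor \<open>norm r\<close> that
    \<open>PdirW\<close> normalizes away.\<close>
  have "g \<bullet> (x - y) \<le> norm r * norm (x - y)"
    using r_le norm_cauchy_schwarz[of r "y - x"] by (simp add: norm_minus_commute)
  then have "pyramidal_width C * (g \<bullet> (x - y)) \<le> norm (x - y) * (norm r * pyramidal_width C)"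
    using mult_left_mono[OF _ w] by (force simp: mult_ac)
  also have "\<dots> \<le> norm (x - y) * (norm r * PdirW (F \<inter> vert C) r x)"
    by (intro mult_left_mono pyramidal_width_le[OF C F xF rF r0]) auto
  also have "\<dots> \<le> norm (x - y) * (r \<bullet> (s - v))"
    using sv by (intro mult_left_mono) auto
  also have "r \<bullet> (s - v) = g \<bullet> (v - s)"
    using sv QF by (auto simp: F_def n_def inner_diff_right inner_diff_left)
  also have "\<dots> \<le> g \<bullet> (pA - pF)"
    using pA[OF sv(2)] pF[of s] sv by (auto simp: F_def inner_diff_right)
  finally show ?thesis by (simp add: mult_left_mono)
qed

section \<open>One-step inequalities between real numbers\<close>

text \<open>\<open>h\<close> and \<open>h'\<close> stand for the primal gap before and after a
  progress step, \<open>g\<close> for the away gap and \<open>e\<close> for the scheduled step size.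
  If \<open>g\<close> exceeds \<open>4 * e * M\<close>, a truncated step would fail the progress
  test, so \<open>\<gamma> = e\<close>; averaging the two bounds on \<open>D\<close> then leaves a
  term \<open>e * g / 4\<close> that pays for the curvature term
  \<open>e\<^sup>2 * M\<close>.\<close>

lemma step_descent_cases:
  fixes h h' g D \<gamma> e a M :: real
  assumes D: "D \<le> - h" "D \<le> - g / 2" and \<gamma>: "0 \<le> \<gamma>" "\<gamma> \<le> e" and M: "0 \<le> M" and h: "0 \<le> h"
    and a: "a \<le> g"
    and descent: "h' \<le> h + \<gamma> * D + \<gamma>\<^sup>2 * M"
    and progress: "(e - \<gamma>) * g \<le> (e\<^sup>2 - \<gamma>\<^sup>2) * (2 * M)"
  shows "(a \<le> 4 * e * M \<and> h' \<le> h + e\<^sup>2 * M) \<or> h' \<le> (1 - e / 2) * h"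
proof (cases "g \<le> 4 * e * M")
  case True
  have "\<gamma> * D \<le> 0" using D h \<gamma> by (simp add: mult_nonneg_nonpos)
  moreover have "\<gamma>\<^sup>2 * M \<le> e\<^sup>2 * M"
    using \<gamma> M by (intro mult_right_mono power_mono)
  ultimately show ?thesis using True a descent by linarith
next
  case False
  have "\<gamma> = e"
  proof (rule ccontr)
    assume "\<gamma> \<noteq> e"
    then have pos: "0 < e - \<gamma>" using \<gamma> by simp
    have "(e - \<gamma>) * g \<le> (e - \<gamma>) * ((e + \<gamma>) * (2 * M))"
      using progress by (simp add: power2_eq_square algebra_simps)
    then have "g \<le> (e + \<gamma>) * (2 * M)" using pos by simp
    also have "\<dots> \<le> (e + e) * (2 * M)"
      using \<gamma> M by (intro mult_right_mono) auto
    finally show False using False by simp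
  qed
  have "e * D \<le> e * (- h / 2 - g / 4)"
    using D \<gamma> by (intro mult_left_mono) auto
  moreover have "e * (4 * e * M) \<le> e * g"
    using False \<gamma> by (intro mult_left_mono) auto
  ultimately show ?thesis
    using descent \<open>\<gamma> = e\<close> by (simp add: power2_eq_square algebra_simps)
qed

text \<open>Failure of the progress test excludes \<open>\<gamma> = e\<close>. Cancelling
  \<open>e - \<gamma>\<close> yields \<open>g > 2 * M * (e + \<gamma>)\<close>, so the linear
  decrease \<open>\<gamma> * g / 2\<close> is at least \<open>\<gamma>\<^sup>2 * M\<close>.\<close>

lemma step_descent_no_progress:
  fixes h h' g D \<gamma> e M :: real
  assumes D: "D \<le> - g / 2" and \<gamma>: "0 \<le> \<gamma>" "\<gamma> \<le> e" and M: "0 \<le> M"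
    and descent: "h' \<le> h + \<gamma> * D + \<gamma>\<^sup>2 * M"
    and no_progress: "(e\<^sup>2 - \<gamma>\<^sup>2) * (2 * M) < (e - \<gamma>) * g"
  shows "h' \<le> h"
proof -
  have "\<gamma> < e" using \<gamma> no_progress by (cases "\<gamma> = e") auto
  moreover have "(e - \<gamma>) * ((e + \<gamma>) * (2 * M)) < (e - \<gamma>) * g"
    using no_progress by (simp add: power2_eq_square algebra_simps)
  ultimately have "(e + \<gamma>) * (2 * M) < g" by simp
  moreover have "\<gamma> * (2 * M) \<le> (e + \<gamma>) * (2 * M)"
    using \<gamma> M by (intro mult_right_mono) auto
  ultimately have "\<gamma> * (D + \<gamma> * M) \<le> 0"
    using D \<gamma> by (intro mult_nonneg_nonpos) (auto simp: algebra_simps)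
  then show ?thesis using descent by (simp add: power2_eq_square algebra_simps)
qed

section \<open>The scalar recursion and its rate\<close>

text \<open>The target bound as a function of the step-size value \<open>e\<close>. It is applied
  with \<open>M = L * \<delta>\<^sup>2 / 2\<close>, \<open>A = \<omega> / \<mu>\<close> and
  \<open>q = 1 / (1 - \<theta>)\<close>.\<close>

definition rate_bound :: "real \<Rightarrow> real \<Rightarrow> real \<Rightarrow> real \<Rightarrow> real" where
  "rate_bound M A q e = max (e powr q * M) ((4 * e * M / A) powr q + e\<^sup>2 * M)"

lemma rate_bound_mono:
  assumes "0 \<le> e" "e \<le> e'" "0 \<le> M" "0 < A" "0 \<le> q"
  shows "rate_bound M A q e \<le> rate_bound M A q e'"
  unfolding rate_bound_def using assms
  by (intro max.mono add_mono mult_right_mono powr_mono2 divide_right_mono mult_left_mono power_mono)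
    auto

text \<open>This is \<open>\<eta>\<^bsub>l - 1\<^esub> \<eta>\<^bsub>l - 2\<^esub>\<close>, a multiple of the product of the contraction factors
  \<open>1 - \<eta>\<^sub>k / 2 = (k + 2) / (k + 4)\<close> over \<open>k < l\<close>. The more obvious \<open>(\<eta>\<^bsub>l - 2\<^esub>)\<^sup>2\<close> decreases
  too fast for an induction directly on the final bound.\<close>

definition decay :: "nat \<Rightarrow> real" where
  "decay l = 16 / ((real l + 3) * (real l + 2))"

lemma decay_pos: "0 < decay l"
  by (simp add: decay_def)

lemma decay_Suc: "decay (Suc l) = (1 - 4 / (real l + 4) / 2) * decay l"
  by (simp add: decay_def divide_simps) (simp add: algebra_simps)

text \<open>The ratio \<open>h t / decay (l t)\<close> does not grow in contracting steps or steps
  without progress, and a progress step with small gap at index \<open>k\<close> resets it to at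
  most \<open>G k / decay (Suc k)\<close>. Since \<open>q \<le> 2\<close>, the decay after the last
  reset is fast enough to turn \<open>e k\<close> into \<open>4 / (real (l t) + 2)\<close>, the step
  size two indices before \<open>l t\<close>.\<close>

lemma open_loop_recursion:
  fixes h :: "nat \<Rightarrow> real" and l :: "nat \<Rightarrow> nat"
  assumes q: "1 \<le> q" "q \<le> 2" and M: "0 \<le> M" and A: "0 < A"
    and nonneg: "\<And>t. t \<le> T \<Longrightarrow> 0 \<le> h t"
    and init: "h 1 \<le> M" "l 1 = 1"
    and step: "\<And>t. 1 \<le> t \<Longrightarrow> t < T \<Longrightarrow>
      l (Suc t) = l t \<and> h (Suc t) \<le> h t \<or>
      l (Suc t) = Suc (l t) \<and>
        (A * h t powr (1 / q) \<le> 4 * (4 / (real (l t) + 4)) * M \<and>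
           h (Suc t) \<le> h t + (4 / (real (l t) + 4))\<^sup>2 * M \<or>
         h (Suc t) \<le> (1 - 4 / (real (l t) + 4) / 2) * h t)"
    and t: "1 \<le> t" "t \<le> T"
  shows "h t \<le> rate_bound M A q (4 / (real (l t) + 2))"
proof -
  define e where "e k = 4 / (real k + 4)" for k
  define G where "G k = (4 * e k * M / A) powr q + (e k)\<^sup>2 * M" for k
  have e_pos: "0 < e k" for k by (simp add: e_def)
  \<comment> \<open>\<open>k\<close> is the index of the last progress step that may increase \<open>h\<close>; from then on \<open>h\<close>
    shrinks at least as fast as \<^const>\<open>decay\<close>.\<close>
  define P where "P t = (h t / decay (l t) \<le> 3 / 4 * M \<or>
    (\<exists>k < l t. h t / decay (l t) \<le> G k / decay (Suc k)))" for t
  have P: "1 \<le> l t \<and> P t"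
    using t
  proof (induction t rule: nat_induct_at_least)
    case base
    \<comment> \<open>\<open>decay 1 = 4 / 3\<close>, whence the factor \<open>3 / 4\<close> in
      \<open>P\<close>.\<close>
    show ?case using init M by (simp add: P_def decay_def)
  next
    case (Suc t)
    then have IH: "1 \<le> l t" "P t" by auto
    have "t < T" using Suc.prems by simp
    have dec: "decay (Suc (l t)) = (1 - e (l t) / 2) * decay (l t)"
      by (simp add: decay_Suc e_def)
    have e2: "0 < 1 - e (l t) / 2" by (simp add: e_def divide_simps)
    have P_mono: "P (Suc t)"
      if "h (Suc t) / decay (l (Suc t)) \<le> h t / decay (l t)" "l t \<le> l (Suc t)"
      using IH(2) that unfolding P_def by (meson order_trans order_less_le_trans)
    consider (stay) "l (Suc t) = l t" "h (Suc t) \<le> h t"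
      | (restart) "l (Suc t) = Suc (l t)" "A * h t powr (1 / q) \<le> 4 * e (l t) * M"
          "h (Suc t) \<le> h t + (e (l t))\<^sup>2 * M"
      | (shrink) "l (Suc t) = Suc (l t)" "h (Suc t) \<le> (1 - e (l t) / 2) * h t"
      using step[OF Suc.hyps \<open>t < T\<close>] unfolding e_def by blast
    then show ?case
    proof cases
      case stay
      then have "h (Suc t) / decay (l (Suc t)) \<le> h t / decay (l t)"
        by (simp add: divide_right_mono less_imp_le[OF decay_pos])
      then show ?thesis using IH stay P_mono by simp
    next
      case restart
      have h: "0 \<le> h t" using nonneg \<open>t < T\<close> by simp
      have "h t powr (1 / q) \<le> 4 * e (l t) * M / A"
        using restart(2) A by (simp add: field_simps)
      then have "(h t powr (1 / q)) powr q \<le> (4 * e (l t) * M / A) powr q"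
        using q by (intro powr_mono2) auto
      then have "h t \<le> (4 * e (l t) * M / A) powr q"
        using q h by (simp add: powr_powr)
      with restart have "h (Suc t) \<le> G (l t)" by (simp add: G_def)
      then have "h (Suc t) / decay (l (Suc t)) \<le> G (l t) / decay (Suc (l t))"
        using restart by (simp add: divide_right_mono less_imp_le[OF decay_pos])
      then show ?thesis using restart unfolding P_def by auto
    next
      case shrink
      then have "h (Suc t) / decay (l (Suc t)) \<le> h t / decay (l t)"
        using e2 decay_pos[of "l t"] by (simp add: dec divide_simps) (simp add: mult_ac)
      then show ?thesis using IH shrink P_mono by simp
    qed
  qed
  define E where "E = 4 / (real (l t) + 2)"
  have E: "0 < E" by (simp add: E_def)
  from P consider (first) "h t / decay (l t) \<le> 3 / 4 * M"
    | (later) k where "k < l t" "h t / decay (l t) \<le> G k / decay (Suc k)"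
    unfolding P_def by blast
  then show ?thesis
  proof cases
    case first
    then have "h t \<le> 3 / 4 * decay (l t) * M"
      using decay_pos[of "l t"] by (simp add: field_simps)
    \<comment> \<open>For \<open>l t = 1\<close> the base \<open>E = 4 / 3\<close> exceeds 1, and
      lowering the exponent from 2 to \<open>q\<close> would go the wrong way; there the left side
      is exactly 1. From \<open>l t = 2\<close> on, \<open>E \<le> 1\<close>.\<close>
    also have "3 / 4 * decay (l t) \<le> E powr q"
    proof (cases "l t = 1")
      case True
      then have "1 powr q \<le> E powr q"
        using q by (intro powr_mono2) (auto simp: E_def)
      then show ?thesis using True by (simp add: decay_def)
    next
      case False
      with P have l2: "2 \<le> real (l t)" by simp
      have "3 / 4 * decay (l t) \<le> E\<^sup>2"
        by (simp add: decay_def E_def power2_eq_square divide_simps)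
      also have "\<dots> = E powr 2" using E by simp
      also have "\<dots> \<le> E powr q"
        using q E l2 by (intro powr_mono') (auto simp: E_def)
      finally show ?thesis .
    qed
    finally show ?thesis
      using M by (simp add: rate_bound_def E_def mult_right_mono)
  next
    case later
    have "h t \<le> (4 * E * M / A) powr q + E\<^sup>2 * M"
    proof (cases "l t = Suc k")
      \<comment> \<open>Right after the reset the scaling factor used below would exceed 1, but
        \<open>e k \<le> E\<close> already suffices.\<close>
      case True
      with later have "h t \<le> G k"
        using decay_pos[of "Suc k"] by (simp add: divide_le_cancel)
      also have "\<dots> \<le> (4 * E * M / A) powr q + E\<^sup>2 * M"
        unfolding G_def using True M A q e_pos[of k]
        by (intro add_mono mult_right_mono powr_mono2 divide_right_mono mult_left_mono power_mono)
          (auto simp: e_def E_def divide_simps)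
      finally show ?thesis .
    next
      case False
      \<comment> \<open>\<open>\<rho>\<close> is the ratio \<open>E / e k\<close>. Because
        \<open>\<rho> \<le> 1\<close> and \<open>q \<le> 2\<close>, the factor
        \<open>\<rho>\<^sup>2\<close> gained from the decay is at most \<open>\<rho> powr q\<close>
        and can be moved inside the power.\<close>
      define \<rho> where "\<rho> = (real k + 4) / (real (l t) + 2)"
      have kl: "real k + 2 \<le> real (l t)" using False later by linarith
      have \<rho>: "0 < \<rho>" "\<rho> \<le> 1" "\<rho> * e k = E"
        using kl by (auto simp: \<rho>_def e_def E_def divide_simps)
      have "decay (l t) / decay (Suc k) =
          (real k + 4) * (real k + 3) / ((real (l t) + 2) * (real (l t) + 3))"
        by (simp add: decay_def divide_simps) (simp add: algebra_simps)
      also have "\<dots> = \<rho> * ((real k + 3) / (real (l t) + 3))"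
        by (simp add: \<rho>_def)
      also have "\<dots> \<le> \<rho> * \<rho>"
        using \<rho>(1) kl by (intro mult_left_mono) (auto simp: \<rho>_def divide_simps algebra_simps)
      finally have ratio: "decay (l t) / decay (Suc k) \<le> \<rho>\<^sup>2" by (simp add: power2_eq_square)
      have G0: "0 \<le> G k" using M by (simp add: G_def)
      have "h t \<le> G k * (decay (l t) / decay (Suc k))"
        using later(2) decay_pos[of "l t"] by (simp add: field_simps)
      also have "\<dots> \<le> G k * \<rho>\<^sup>2"
        by (intro mult_left_mono ratio G0)
      also have "\<dots> = \<rho> powr 2 * (4 * e k * M / A) powr q + (\<rho> * e k)\<^sup>2 * M"
        using \<rho>(1) by (simp add: G_def algebra_simps power_mult_distrib)
      also have "\<dots> \<le> \<rho> powr q * (4 * e k * M / A) powr q + (\<rho> * e k)\<^sup>2 * M"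
        using q M \<rho> by (intro add_mono mult_right_mono powr_mono') auto
      also have "\<rho> powr q * (4 * e k * M / A) powr q = (\<rho> * (4 * e k * M / A)) powr q"
        using \<rho>(1) M A e_pos[of k] by (subst powr_mult) auto
      also have "\<rho> * (4 * e k * M / A) = 4 * (\<rho> * e k) * M / A" by simp
      finally show ?thesis by (simp add: \<rho>)
    qed
    then show ?thesis by (simp add: rate_bound_def E_def)
  qed
qed

section \<open>Vertex weights and the invariant of a run\<close>

text \<open>Common form of both weight updates: \<open>b = 1 - \<gamma>\<close>,
  \<open>c = \<gamma>\<close> for a Frank-Wolfe step and \<open>b = 1 + \<gamma>\<close>,
  \<open>c = - \<gamma>\<close> for an away step.\<close>

lemma sum_affine_update:
  fixes w w' :: "'a::real_vector \<Rightarrow> real"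
  assumes "finite V" "a \<in> V" and a: "w' a = b * w a + c" and p: "\<And>p. p \<in> V - {a} \<Longrightarrow> w' p = b * w p"
  shows "sum w' V = b * sum w V + c"
    and "(\<Sum>p\<in>V. w' p *\<^sub>R p) = b *\<^sub>R (\<Sum>p\<in>V. w p *\<^sub>R p) + c *\<^sub>R a"
proof -
  have w': "w' p = b * w p + (if p = a then c else 0)" if "p \<in> V" for p
    using a p[of p] that by auto
  have "sum w' V = (\<Sum>p\<in>V. b * w p + (if p = a then c else 0))"
    by (intro sum.cong refl w')
  then show "sum w' V = b * sum w V + c"
    using assms(1,2) by (simp add: sum.distrib sum_distrib_left)
  have "w' p *\<^sub>R p = b *\<^sub>R w p *\<^sub>R p + (if p = a then c *\<^sub>R a else 0)" if "p \<in> V" for p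
    unfolding w'[OF that] by (simp add: scaleR_left_distrib)
  then have "(\<Sum>p\<in>V. w' p *\<^sub>R p) = (\<Sum>p\<in>V. b *\<^sub>R w p *\<^sub>R p + (if p = a then c *\<^sub>R a else 0))"
    by (rule sum.cong[OF refl])
  then show "(\<Sum>p\<in>V. w' p *\<^sub>R p) = b *\<^sub>R (\<Sum>p\<in>V. w p *\<^sub>R p) + c *\<^sub>R a"
    using assms(1,2) by (simp add: sum.distrib scaleR_sum_right)
qed

text \<open>Turns the existential witnesses of \<open>afw_iterates\<close> into fixed parameters,
  together with the assumptions on \<open>C\<close> and \<open>f\<close>.\<close>

locale afw_run =
  fixes C :: "'a::euclidean_space set" and f :: "'a \<Rightarrow> real" and L :: real and \<eta> :: "int \<Rightarrow> real"
    and T :: nat and x :: "nat \<Rightarrow> 'a"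
    and pF pA :: "nat \<Rightarrow> 'a" and S :: "nat \<Rightarrow> 'a set" and lam :: "nat \<Rightarrow> 'a \<Rightarrow> real"
    and l :: "nat \<Rightarrow> nat" and d :: "nat \<Rightarrow> 'a" and \<eta>max \<gamma> :: "nat \<Rightarrow> real"
  assumes polytope: "polytope C"
    and convex_f: "convex_on C f"
    and smooth: "L_smooth_on C f L"
    and eta_range: "\<And>k::nat. \<eta> (int k) \<in> {0..1}"
    and x0: "x 0 \<in> vert C" and S0: "S 0 = {x 0}" and lam0: "lam 0 (x 0) = 1"
    and lam0': "\<And>p. p \<in> vert C - {x 0} \<Longrightarrow> lam 0 p = 0" and l0: "l 0 = 0"
    and pF_vert: "\<And>t. t < T \<Longrightarrow> pF t \<in> vert C"
    and pF_min: "\<And>t. t < T \<Longrightarrow> is_arg_min (\<lambda>p. grad f (x t) \<bullet> (p - x t)) (\<lambda>p. p \<in> C) (pF t)"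
    and pA_max: "\<And>t. t < T \<Longrightarrow> is_arg_max (\<lambda>p. grad f (x t) \<bullet> (p - x t)) (\<lambda>p. p \<in> S t) (pA t)"
    and gamma: "\<And>t. t < T \<Longrightarrow> \<gamma> t = min (\<eta> (int (l t))) (\<eta>max t)"
    and x_Suc: "\<And>t. t < T \<Longrightarrow> x (Suc t) = x t + \<gamma> t *\<^sub>R d t"
    and direction: "\<And>t. t < T \<Longrightarrow>
      (if grad f (x t) \<bullet> (pF t - x t) \<le> grad f (x t) \<bullet> (x t - pA t)
       then d t = pF t - x t \<and> \<eta>max t = 1 \<and>
            lam (Suc t) (pF t) = (1 - \<gamma> t) * lam t (pF t) + \<gamma> t \<and>
            (\<forall>p \<in> vert C - {pF t}. lam (Suc t) p = (1 - \<gamma> t) * lam t p)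
       else d t = x t - pA t \<and> \<eta>max t = lam t (pA t) / (1 - lam t (pA t)) \<and>
            lam (Suc t) (pA t) = (1 + \<gamma> t) * lam t (pA t) - \<gamma> t \<and>
            (\<forall>p \<in> vert C - {pA t}. lam (Suc t) p = (1 + \<gamma> t) * lam t p))"
    and S_Suc: "\<And>t. t < T \<Longrightarrow> S (Suc t) = {p \<in> vert C. 0 < lam (Suc t) p}"
    and l_Suc: "\<And>t. t < T \<Longrightarrow> l (Suc t) =
      (if (\<eta> (int (l t)) - \<gamma> t) * (grad f (x t) \<bullet> (pA t - pF t))
            \<le> ((\<eta> (int (l t)))\<^sup>2 - (\<gamma> t)\<^sup>2) * L * (diameter C)\<^sup>2
       then l t + 1 else l t)"
begin

definition fw_step :: "nat \<Rightarrow> bool" where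
  "fw_step t \<longleftrightarrow> grad f (x t) \<bullet> (pF t - x t) \<le> grad f (x t) \<bullet> (x t - pA t)"

text \<open>The loop invariant. The algorithm only prescribes updates of \<open>lam\<close> and
  \<open>x\<close> separately; that they stay consistent has to be proved.\<close>

definition state_ok :: "nat \<Rightarrow> bool" where
  "state_ok t \<longleftrightarrow> (\<forall>p\<in>vert C. 0 \<le> lam t p) \<and> sum (lam t) (vert C) = 1 \<and>
     (\<Sum>p\<in>vert C. lam t p *\<^sub>R p) = x t \<and> S t = {p \<in> vert C. 0 < lam t p}"

lemma fin_vert [simp]: "finite (vert C)"
  by (rule finite_vert[OF polytope])

lemma vert_in: "p \<in> vert C \<Longrightarrow> p \<in> C"
  by (simp add: vert_def extreme_point_of_def)

lemma x_in:
  assumes "state_ok t"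
  shows "x t \<in> C"
proof -
  have "(\<Sum>p\<in>vert C. lam t p *\<^sub>R p) \<in> C"
    using assms polytope_imp_convex[OF polytope]
    by (intro convex_sum) (auto simp: state_ok_def vert_in)
  then show ?thesis using assms by (simp add: state_ok_def)
qed

lemma x_support:
  assumes "state_ok t"
  shows "sum (lam t) (S t) = 1" "(\<Sum>p\<in>S t. lam t p *\<^sub>R p) = x t"
proof -
  have sub: "S t \<subseteq> vert C" and zero: "\<forall>p \<in> vert C - S t. lam t p = 0"
    using assms by (force simp: state_ok_def)+
  have "sum (lam t) (S t) = sum (lam t) (vert C)"
    by (rule sum.mono_neutral_left[OF fin_vert sub zero])
  then show "sum (lam t) (S t) = 1"
    using assms by (simp add: state_ok_def)
  have "(\<Sum>p\<in>S t. lam t p *\<^sub>R p) = (\<Sum>p\<in>vert C. lam t p *\<^sub>R p)"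
    by (rule sum.mono_neutral_left[OF fin_vert sub]) (use zero in simp)
  then show "(\<Sum>p\<in>S t. lam t p *\<^sub>R p) = x t"
    using assms by (simp add: state_ok_def)
qed

lemma pF_le: "t < T \<Longrightarrow> p \<in> C \<Longrightarrow> grad f (x t) \<bullet> pF t \<le> grad f (x t) \<bullet> p"
  using pF_min[of t] by (auto simp: is_arg_min_linorder inner_diff_right)

lemma pA_ge: "t < T \<Longrightarrow> p \<in> S t \<Longrightarrow> grad f (x t) \<bullet> p \<le> grad f (x t) \<bullet> pA t"
  using pA_max[of t] by (auto simp: is_arg_max_linorder inner_diff_right)

lemma pA_in: "t < T \<Longrightarrow> pA t \<in> S t"
  using pA_max[of t] by (simp add: is_arg_max_def)

text \<open>\<open>x t\<close> is a weighted average of the active set, so the maximum of a linear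
  functional over that set is at least its value at \<open>x t\<close>.\<close>

lemma pA_ge_x:
  assumes "t < T" "state_ok t"
  shows "grad f (x t) \<bullet> x t \<le> grad f (x t) \<bullet> pA t"
proof -
  have "grad f (x t) \<bullet> x t = (\<Sum>p\<in>S t. lam t p * (grad f (x t) \<bullet> p))"
    unfolding x_support(2)[OF assms(2), symmetric] by (simp add: inner_sum_right)
  also have "\<dots> \<le> (\<Sum>p\<in>S t. lam t p * (grad f (x t) \<bullet> pA t))"
    using assms by (intro sum_mono mult_left_mono pA_ge) (auto simp: state_ok_def)
  also have "\<dots> = grad f (x t) \<bullet> pA t"
    by (simp add: x_support(1)[OF assms(2)] flip: sum_distrib_right)
  finally show ?thesis .
qed

lemma pA_weight:
  assumes "t < T" "state_ok t"
  shows "0 < lam t (pA t)" "pA t \<in> vert C"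
  using pA_in[of t] assms by (auto simp: state_ok_def)

text \<open>A weight of 1 would force all others to vanish and \<open>x t = pA t\<close>; the away
  side of the test would be 0 and the Frank-Wolfe step would be chosen. Hence the away cap has a
  positive denominator.\<close>

lemma pA_weight_less_1:
  assumes "t < T" "state_ok t" "\<not> fw_step t"
  shows "lam t (pA t) < 1"
proof (rule ccontr)
  assume neg: "\<not> lam t (pA t) < 1"
  have nonneg: "\<And>p. p \<in> vert C \<Longrightarrow> 0 \<le> lam t p"
    using assms by (auto simp: state_ok_def)
  have split: "lam t (pA t) + sum (lam t) (vert C - {pA t}) = 1"
    using assms pA_weight(2)[OF assms(1,2)] by (simp add: state_ok_def flip: sum.remove)
  moreover have "0 \<le> sum (lam t) (vert C - {pA t})"
    using nonneg by (intro sum_nonneg) auto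
  ultimately have one: "lam t (pA t) = 1" and "sum (lam t) (vert C - {pA t}) = 0"
    using neg by linarith+
  then have zero: "lam t p = 0" if "p \<in> vert C - {pA t}" for p
    using nonneg that by (subst (asm) sum_nonneg_eq_0_iff) auto
  have "x t = (\<Sum>p\<in>vert C. lam t p *\<^sub>R p)"
    using assms by (simp add: state_ok_def)
  also have "\<dots> = lam t (pA t) *\<^sub>R pA t + (\<Sum>p\<in>vert C - {pA t}. lam t p *\<^sub>R p)"
    using pA_weight(2)[OF assms(1,2)] by (simp add: sum.remove)
  also have "\<dots> = pA t" by (simp add: one zero)
  finally have "x t = pA t" .
  then have "fw_step t"
    using pF_le[OF assms(1) x_in[OF assms(2)]] by (simp add: fw_step_def inner_diff_right)
  then show False using assms by simp
qed

text \<open>The cap 1 never truncates, since the scheduled step sizes lie in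
  \<open>{0..1}\<close>.\<close>

lemma fw_stepD:
  assumes "t < T" "fw_step t"
  shows "d t = pF t - x t" "\<gamma> t = \<eta> (int (l t))"
    "lam (Suc t) (pF t) = (1 - \<gamma> t) * lam t (pF t) + \<gamma> t"
    "\<And>p. p \<in> vert C - {pF t} \<Longrightarrow> lam (Suc t) p = (1 - \<gamma> t) * lam t p"
  using direction[OF assms(1)] gamma[OF assms(1)] assms(2) eta_range[of "l t"]
  unfolding fw_step_def by auto

lemma away_stepD:
  assumes "t < T" "\<not> fw_step t"
  shows "d t = x t - pA t" "\<gamma> t = min (\<eta> (int (l t))) (lam t (pA t) / (1 - lam t (pA t)))"
    "lam (Suc t) (pA t) = (1 + \<gamma> t) * lam t (pA t) - \<gamma> t"
    "\<And>p. p \<in> vert C - {pA t} \<Longrightarrow> lam (Suc t) p = (1 + \<gamma> t) * lam t p"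
  using direction[OF assms(1)] gamma[OF assms(1)] assms(2)
  unfolding fw_step_def by auto

lemma gamma_le: "t < T \<Longrightarrow> \<gamma> t \<le> \<eta> (int (l t))"
  by (simp add: gamma)

lemma gamma_nonneg:
  assumes "t < T" "state_ok t"
  shows "0 \<le> \<gamma> t"
proof (cases "fw_step t")
  case True
  then show ?thesis using fw_stepD(2)[OF assms(1)] eta_range[of "l t"] by simp
next
  case False
  then show ?thesis
    using away_stepD(2)[OF assms(1) False] eta_range[of "l t"] pA_weight(1)[OF assms]
      pA_weight_less_1[OF assms] by simp
qed

lemma state_ok_0: "state_ok 0"
proof -
  have lam: "lam 0 p = (if p = x 0 then 1 else 0)" if "p \<in> vert C" for p
    using lam0 lam0' that by auto
  have "sum (lam 0) (vert C) = (\<Sum>p\<in>vert C. if p = x 0 then 1 else 0)"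
    by (intro sum.cong refl lam)
  then have "sum (lam 0) (vert C) = 1"
    using x0 by simp
  moreover have "lam 0 p *\<^sub>R p = (if p = x 0 then x 0 else 0)" if "p \<in> vert C" for p
    using lam[OF that] by simp
  then have "(\<Sum>p\<in>vert C. lam 0 p *\<^sub>R p) = (\<Sum>p\<in>vert C. if p = x 0 then x 0 else 0)"
    by (rule sum.cong[OF refl])
  then have "(\<Sum>p\<in>vert C. lam 0 p *\<^sub>R p) = x 0"
    using x0 by simp
  moreover have "\<forall>p\<in>vert C. 0 \<le> lam 0 p" "S 0 = {p \<in> vert C. 0 < lam 0 p}"
    using lam x0 S0 by (auto split: if_splits)
  ultimately show ?thesis
    unfolding state_ok_def by blast
qed

text \<open>Only the weight at \<open>a\<close> can turn negative, when \<open>c < 0\<close>; its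
  sign is therefore a separate assumption.\<close>

lemma state_ok_affine_update:
  assumes t: "t < T" and ok: "state_ok t" and a: "a \<in> vert C" and b: "0 \<le> b" "b + c = 1"
    and lam: "lam (Suc t) a = b * lam t a + c" "\<And>p. p \<in> vert C - {a} \<Longrightarrow> lam (Suc t) p = b * lam t p"
    and nonneg: "0 \<le> lam (Suc t) a" and x: "x (Suc t) = b *\<^sub>R x t + c *\<^sub>R a"
  shows "state_ok (Suc t)"
proof -
  have ok': "\<And>p. p \<in> vert C \<Longrightarrow> 0 \<le> lam t p" "sum (lam t) (vert C) = 1"
      "(\<Sum>p\<in>vert C. lam t p *\<^sub>R p) = x t"
    using ok by (simp_all add: state_ok_def)
  have "0 \<le> lam (Suc t) p" if "p \<in> vert C" for p
  proof (cases "p = a")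
    case False
    then have "lam (Suc t) p = b * lam t p" using that by (intro lam(2)) simp
    then show ?thesis using b(1) ok'(1)[OF that] by simp
  qed (use nonneg in simp)
  moreover note upd = sum_affine_update[where w = "lam t" and w' = "lam (Suc t)", OF fin_vert a lam]
  have "sum (lam (Suc t)) (vert C) = 1"
    using upd(1) ok'(2) b(2) by simp
  moreover have "(\<Sum>p\<in>vert C. lam (Suc t) p *\<^sub>R p) = x (Suc t)"
    using upd(2) ok'(3) x by simp
  ultimately show ?thesis
    unfolding state_ok_def using S_Suc[OF t] by blast
qed

lemma state_ok_Suc:
  assumes t: "t < T" and ok: "state_ok t"
  shows "state_ok (Suc t)"
proof (cases "fw_step t")
  case True
  note D = fw_stepD[OF t True]
  have \<gamma>: "0 \<le> \<gamma> t" "\<gamma> t \<le> 1" using D(2) eta_range[of "l t"] by auto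
  have "0 \<le> lam t (pF t)" using ok pF_vert[OF t] by (simp add: state_ok_def)
  then have "0 \<le> lam (Suc t) (pF t)" using \<gamma> by (simp add: D(3))
  moreover have "x (Suc t) = (1 - \<gamma> t) *\<^sub>R x t + \<gamma> t *\<^sub>R pF t"
    by (simp add: x_Suc[OF t] D(1) algebra_simps)
  ultimately show ?thesis
    using \<gamma> by (intro state_ok_affine_update[OF t ok pF_vert[OF t] _ _ D(3,4)]) simp_all
next
  case False
  note D = away_stepD[OF t False] and w = pA_weight[OF t ok] and w1 = pA_weight_less_1[OF t ok False]
  have \<gamma>: "0 \<le> \<gamma> t" using t ok by (rule gamma_nonneg)
  have "\<gamma> t \<le> lam t (pA t) / (1 - lam t (pA t))" using D(2) by simp
  \<comment> \<open>The new weight of \<open>pA t\<close> is its old weight minus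
    \<open>\<gamma> t * (1 - lam t (pA t))\<close>, so the cap is exactly what keeps it
    nonnegative.\<close>
  then have "\<gamma> t * (1 - lam t (pA t)) \<le> lam t (pA t)"
    using w1 by (simp add: field_simps)
  then have "0 \<le> lam (Suc t) (pA t)" by (simp add: D(3) algebra_simps)
  moreover have "x (Suc t) = (1 + \<gamma> t) *\<^sub>R x t + (- \<gamma> t) *\<^sub>R pA t"
    by (simp add: x_Suc[OF t] D(1) algebra_simps)
  moreover have "lam (Suc t) (pA t) = (1 + \<gamma> t) * lam t (pA t) + - \<gamma> t" by (simp add: D(3))
  ultimately show ?thesis
    using \<gamma> by (intro state_ok_affine_update[where c = "- \<gamma> t", OF t ok w(2) _ _ _ D(4)]) simp_all
qed

lemma state_ok: "t \<le> T \<Longrightarrow> state_ok t"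
  by (induction t) (auto simp: state_ok_0 state_ok_Suc)

lemma L_pos: "0 < L"
  using smooth by (simp add: L_smooth_on_def)

section \<open>Counting progress steps\<close>

text \<open>Without truncation both sides of the progress test are 0.\<close>

lemma progress_if_full_step:
  assumes "t < T" "\<gamma> t = \<eta> (int (l t))"
  shows "l (Suc t) = l t + 1"
  using assms by (simp add: l_Suc)

text \<open>Every step without progress drops a vertex from the active set, and only Frank--Wolfe steps,
  which always make progress, add one.\<close>

lemma active_set_card:
  assumes "t \<le> T"
  shows "card (S t) + t \<le> 2 * l t + 1"
  using assms
proof (induction t)
  case 0
  then show ?case by (simp add: S0)
next
  case (Suc t)
  then have t: "t < T" and IH: "card (S t) + t \<le> 2 * l t + 1" and ok: "state_ok t"
    by (auto simp: state_ok)
  have S: "S t = {p \<in> vert C. 0 < lam t p}" using ok by (simp add: state_ok_def)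
  then have fin: "finite (S t)" by simp
  show ?case
  proof (cases "fw_step t")
    case True
    note D = fw_stepD[OF t True]
    have \<gamma>: "0 \<le> \<gamma> t" "\<gamma> t \<le> 1" using D eta_range[of "l t"] by auto
    have "S (Suc t) \<subseteq> insert (pF t) (S t)"
      using \<gamma> by (auto simp: S S_Suc[OF t] D(4) zero_less_mult_iff)
    then have "card (S (Suc t)) \<le> card (S t) + 1"
      using fin card_mono[of "insert (pF t) (S t)" "S (Suc t)"] card_insert_le_m1
      by (simp add: card_insert_if split: if_splits)
    then show ?thesis
      using IH progress_if_full_step[OF t D(2)] by simp
  next
    case False
    note D = away_stepD[OF t False] and w = pA_weight[OF t ok] and w1 = pA_weight_less_1[OF t ok False]
    have \<gamma>: "0 \<le> \<gamma> t" using t ok by (rule gamma_nonneg)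
    have sub: "S (Suc t) \<subseteq> S t"
    proof
      fix p assume "p \<in> S (Suc t)"
      then show "p \<in> S t"
        using \<gamma> w by (cases "p = pA t") (auto simp: S S_Suc[OF t] D(4) zero_less_mult_iff)
    qed
    show ?thesis
    proof (cases "l (Suc t) = l t + 1")
      case True
      then show ?thesis using IH card_mono[OF fin sub] by simp
    next
      case no: False
      \<comment> \<open>An away step without progress is truncated, so its size equals the cap and
        the weight of \<open>pA t\<close> drops to 0.\<close>
      then have "\<gamma> t = lam t (pA t) / (1 - lam t (pA t))"
        using D(2) progress_if_full_step[OF t] by (auto simp: min_def split: if_splits)
      then have "lam (Suc t) (pA t) = 0"
        using w1 by (simp add: D(3) field_simps)
      then have "pA t \<notin> S (Suc t)" by (simp add: S_Suc[OF t])
      then have "card (S (Suc t)) < card (S t)"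
        using sub pA_in[OF t] by (intro psubset_card_mono fin) auto
      moreover have "l (Suc t) = l t" using no l_Suc[OF t] by (auto split: if_splits)
      ultimately show ?thesis using IH by simp
    qed
  qed
qed

text \<open>The weights on the active set sum to 1, so it is nonempty and its cardinality absorbs
  the 1 in \<open>active_set_card\<close>.\<close>

lemma half_le_progress:
  assumes "t \<le> T"
  shows "t \<le> 2 * l t"
proof -
  have ok: "state_ok t" using assms by (rule state_ok)
  then have "finite (S t)" by (simp add: state_ok_def)
  moreover have "S t \<noteq> {}" using x_support(1)[OF ok] by auto
  ultimately have "0 < card (S t)" by (simp add: card_gt_0_iff)
  then show ?thesis using active_set_card[OF assms] by linarith
qed

text \<open>Initially \<open>pA 0 = x 0\<close>, so the away side of the test is 0.\<close>

lemma fw_step_0: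
  assumes "0 < T"
  shows "fw_step 0"
proof -
  have "pA 0 = x 0" using pA_in[OF assms] by (simp add: S0)
  then show ?thesis
    using pF_le[OF assms vert_in[OF x0]] by (simp add: fw_step_def inner_diff_right)
qed

lemma l_1: "0 < T \<Longrightarrow> l 1 = 1"
  using progress_if_full_step[OF _ fw_stepD(2)[OF _ fw_step_0]] by (simp add: l0)

section \<open>Descent and gap along a run\<close>

lemma norm_d_le:
  assumes t: "t < T"
  shows "norm (d t) \<le> diameter C"
proof -
  have ok: "state_ok t" using t by (simp add: state_ok)
  have b: "bounded C" by (rule polytope_imp_bounded[OF polytope])
  show ?thesis
    using diameter_bounded_bound[OF b, of "pF t" "x t"] diameter_bounded_bound[OF b, of "x t" "pA t"]
      fw_stepD(1)[OF t] away_stepD(1)[OF t] x_in[OF ok] vert_in[OF pF_vert[OF t]]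
      vert_in[OF pA_weight(2)[OF t ok]]
    by (cases "fw_step t") (auto simp: dist_norm)
qed

lemma descent:
  assumes t: "t < T"
  shows "f (x (Suc t)) \<le> f (x t) + \<gamma> t * (grad f (x t) \<bullet> d t) + (\<gamma> t)\<^sup>2 * (L * (diameter C)\<^sup>2 / 2)"
proof -
  have ok: "state_ok t" "state_ok (Suc t)" using t by (simp_all add: state_ok)
  have "f (x (Suc t)) \<le> f (x t) + grad f (x t) \<bullet> (x (Suc t) - x t) + L / 2 * (norm (x t - x (Suc t)))\<^sup>2"
    using smooth x_in ok by (simp add: L_smooth_on_def)
  also have "\<dots> = f (x t) + \<gamma> t * (grad f (x t) \<bullet> d t) + (\<gamma> t)\<^sup>2 * (L * (norm (d t))\<^sup>2 / 2)"
    by (simp add: x_Suc[OF t] power_mult_distrib)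
  also have "\<dots> \<le> f (x t) + \<gamma> t * (grad f (x t) \<bullet> d t) + (\<gamma> t)\<^sup>2 * (L * (diameter C)\<^sup>2 / 2)"
    using L_pos norm_d_le[OF t]
    by (intro add_left_mono mult_left_mono divide_right_mono power_mono) auto
  finally show ?thesis .
qed

lemma gradient_inequality:
  assumes "t \<le> T" "y \<in> C"
  shows "f (x t) - f y \<le> grad f (x t) \<bullet> (x t - y)"
proof -
  have "x t \<in> C" using assms by (intro x_in state_ok)
  moreover from this have "f differentiable (at (x t))"
    using smooth by (auto simp: L_smooth_on_def)
  ultimately show ?thesis
    using convex_gradient_inequality[OF convex_f _ _ assms(2), of "x t"] by (simp add: inner_diff_right)
qed

text \<open>The test picks the smaller of two inner products, which is at most the Frank-Wolfe one
  and at most their average, minus half the away gap.\<close>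

lemma direction_bounds:
  assumes t: "t < T"
  shows "grad f (x t) \<bullet> d t \<le> grad f (x t) \<bullet> (pF t - x t)"
    and "grad f (x t) \<bullet> d t \<le> - (grad f (x t) \<bullet> (pA t - pF t)) / 2"
  using fw_stepD(1)[OF t] away_stepD(1)[OF t]
  by (cases "fw_step t"; simp add: fw_step_def inner_diff_right)+

lemma holder_gap:
  assumes t: "t < T" and xs: "xs \<in> C" "f xs \<le> f (x t)"
    and w: "0 < pyramidal_width C" and \<mu>: "0 < \<mu>" and heb: "holder_error_bound C f xs \<mu> \<theta>"
  shows "pyramidal_width C / \<mu> * (f (x t) - f xs) powr (1 - \<theta>)
    \<le> grad f (x t) \<bullet> (pA t - pF t)"
proof -
  let ?h = "f (x t) - f xs" and ?g = "grad f (x t) \<bullet> (pA t - pF t)" and ?w = "pyramidal_width C"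
  have ok: "state_ok t" using t by (simp add: state_ok)
  have xC: "x t \<in> C" by (rule x_in[OF ok])
  have g: "0 \<le> ?g"
    using pA_ge_x[OF t ok] pF_le[OF t xC] by (simp add: inner_diff_right)
  show ?thesis
  proof (cases "?h = 0")
    \<comment> \<open>At a zero primal gap the power is 0 and the claim reduces to a nonnegative
      away gap; the scaling inequality requires a strictly positive inner product.\<close>
    case True
    then show ?thesis using g by simp
  next
    case False
    then have h: "0 < ?h" using xs by simp
    have hg: "?h \<le> grad f (x t) \<bullet> (x t - xs)"
      using gradient_inequality[of t xs] t xs by simp
    have "?w * ?h \<le> ?w * (grad f (x t) \<bullet> (x t - xs))"
      using w hg by (intro mult_left_mono) auto
    also have "\<dots> \<le> norm (x t - xs) * ?g"
    proof (rule pyramidal_width_scaling[OF polytope, where u = "lam t" and Q = "S t"])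
      show "S t \<subseteq> vert C" "\<And>v. v \<in> S t \<Longrightarrow> 0 < lam t v"
        using ok by (auto simp: state_ok_def)
    qed (use x_support[OF ok] xC xs pF_le[OF t] pA_ge[OF t] w h hg in auto)
    also have "\<dots> \<le> \<mu> * ?h powr \<theta> * ?g"
      using heb xC g by (intro mult_right_mono) (auto simp: holder_error_bound_def)
    finally have "?w * ?h \<le> \<mu> * ?h powr \<theta> * ?g" .
    then have "?w / \<mu> * (?h / ?h powr \<theta>) \<le> ?g"
      using \<mu> h by (simp add: field_simps)
    then show ?thesis using h by (simp add: powr_diff)
  qed
qed

text \<open>The first step has size 1 and lands on the Frank-Wolfe vertex. By convexity its linear
  term cancels the initial primal gap, leaving only the curvature term.\<close>

lemma first_iterate:
  assumes "0 < T" "\<eta> 0 = 1" "xs \<in> C"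
  shows "f (x 1) - f xs \<le> L * (diameter C)\<^sup>2 / 2"
proof -
  note D = fw_stepD[OF assms(1) fw_step_0[OF assms(1)]]
  have "grad f (x 0) \<bullet> d 0 \<le> grad f (x 0) \<bullet> (xs - x 0)"
    using pF_le[OF assms(1,3)] by (simp add: D(1) inner_diff_right)
  moreover have "f (x 0) - f xs \<le> grad f (x 0) \<bullet> (x 0 - xs)"
    using assms by (intro gradient_inequality) auto
  moreover have "\<gamma> 0 = 1" using D(2) assms by (simp add: l0)
  ultimately show ?thesis
    using descent[OF assms(1)] by (simp add: inner_diff_right)
qed

text \<open>Supplies the step hypothesis of \<open>open_loop_recursion\<close>, splitting on the
  progress test.\<close>

lemma iteration_cases:
  assumes t: "t < T" and xs: "xs \<in> C" "\<And>y. y \<in> C \<Longrightarrow> f xs \<le> f y"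
    and w: "0 < pyramidal_width C" and \<mu>: "0 < \<mu>" and heb: "holder_error_bound C f xs \<mu> \<theta>"
  defines "h \<equiv> \<lambda>t. f (x t) - f xs" and "e \<equiv> \<eta> (int (l t))" and "M \<equiv> L * (diameter C)\<^sup>2 / 2"
  shows "l (Suc t) = l t \<and> h (Suc t) \<le> h t \<or>
      l (Suc t) = Suc (l t) \<and>
        (pyramidal_width C / \<mu> * h t powr (1 - \<theta>) \<le> 4 * e * M \<and> h (Suc t) \<le> h t + e\<^sup>2 * M \<or>
         h (Suc t) \<le> (1 - e / 2) * h t)"
proof -
  let ?g = "grad f (x t) \<bullet> (pA t - pF t)" and ?D = "grad f (x t) \<bullet> d t"
  have ok: "state_ok t" using t by (simp add: state_ok)
  have h: "0 \<le> h t" using xs x_in[OF ok] by (simp add: h_def)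
  have M: "0 \<le> M" using L_pos by (simp add: M_def)
  have \<gamma>: "0 \<le> \<gamma> t" "\<gamma> t \<le> e"
    using gamma_nonneg[OF t ok] gamma_le[OF t] by (auto simp: e_def)
  have D1: "?D \<le> - h t"
    using direction_bounds(1)[OF t] pF_le[OF t xs(1)] gradient_inequality[of t xs] t xs
    by (simp add: h_def inner_diff_right)
  have a: "pyramidal_width C / \<mu> * h t powr (1 - \<theta>) \<le> ?g"
    unfolding h_def using holder_gap[OF t xs(1) _ w \<mu> heb] xs(2) x_in[OF ok] by blast
  have desc: "h (Suc t) \<le> h t + \<gamma> t * ?D + (\<gamma> t)\<^sup>2 * M"
    using descent[OF t] by (simp add: h_def M_def)
  show ?thesis
  \<comment> \<open>This is the progress test, since \<open>2 * M\<close> equals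
    \<open>L * (diameter C)\<^sup>2\<close>.\<close>
  proof (cases "(e - \<gamma> t) * ?g \<le> (e\<^sup>2 - (\<gamma> t)\<^sup>2) * (2 * M)")
    case True
    then have "l (Suc t) = Suc (l t)" by (simp add: l_Suc[OF t] e_def M_def mult_ac)
    then show ?thesis
      using step_descent_cases[OF D1 direction_bounds(2)[OF t] \<gamma> M h a desc True] by blast
  next
    case False
    then have "l (Suc t) = l t" by (simp add: l_Suc[OF t] e_def M_def mult_ac)
    moreover have "h (Suc t) \<le> h t"
      using step_descent_no_progress[OF direction_bounds(2)[OF t] \<gamma> M desc] False by simp
    ultimately show ?thesis by blast
  qed
qed

end

section \<open>From the algorithm to the final bound\<close>

lemma afw_iterates_imp_run:
  assumes "polytope C" "convex_on C f" "L_smooth_on C f L" "afw_iterates C f L \<eta> T x"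
  obtains pF pA S lam l d \<eta>max \<gamma> where "afw_run C f L \<eta> T x pF pA S lam l d \<eta>max \<gamma>"
  using assms(4) unfolding afw_iterates_def
  apply (elim conjE exE)
  subgoal premises prems for pF pA S lam l d \<eta>max \<gamma>
  proof (rule that[of pF pA S lam l d \<eta>max \<gamma>], unfold_locales, goal_cases)
    case 4
    show ?case using prems(2) by blast
  next
    case (8 p)
    then show ?case using prems(6) by blast
  qed (rule assms prems | drule prems(8)[THEN spec, THEN mp], elim conjE, assumption)+
  done

theorem theorem5p9:
  fixes C :: "'a::euclidean_space set"
    and f :: "'a \<Rightarrow> real"
    and L \<delta> \<omega> \<mu> \<theta> :: real
    and xs :: 'a
    and T :: nat
    and \<eta> :: "int \<Rightarrow> real"
    and x :: "nat \<Rightarrow> 'a"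
    and h :: "nat \<Rightarrow> real"
  assumes "polytope C"
    and "\<delta> = diameter C" and "\<delta> > 0"
    and "\<omega> = pyramidal_width C" and "\<omega> > 0"
    and "convex_on C f"
    and "L_smooth_on C f L"
    and "\<mu> > 0" and "\<theta> \<in> {0..1/2}"
    and "is_arg_min f (\<lambda>y. y \<in> C) xs"
    and "\<And>y. is_arg_min f (\<lambda>y. y \<in> C) y \<Longrightarrow> y = xs"
    and "holder_error_bound C f xs \<mu> \<theta>"
    and "\<And>t. \<eta> t = 4 / (real_of_int t + 4)"
    and "afw_iterates C f L \<eta> T x"
    and "\<And>t. h t = f (x t) - f xs"
  shows "\<forall>t \<in> {1..T}.
    h t \<le> max
      (\<eta> \<lceil>real t / 2 - 2\<rceil> powr (1 / (1 - \<theta>)) * (L * \<delta>\<^sup>2 / 2))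
      ((\<eta> \<lceil>real t / 2 - 2\<rceil> * 2 * \<mu> * L * \<delta>\<^sup>2 / \<omega>) powr (1 / (1 - \<theta>))
        + (\<eta> \<lceil>real t / 2 - 2\<rceil>)\<^sup>2 * (L * \<delta>\<^sup>2 / 2))"
proof
  fix t assume t: "t \<in> {1..T}"
  obtain pF pA S lam l d \<eta>max \<gamma> where "afw_run C f L \<eta> T x pF pA S lam l d \<eta>max \<gamma>"
    by (rule afw_iterates_imp_run[OF assms(1,6,7,14)])
  then interpret afw_run C f L \<eta> T x pF pA S lam l d \<eta>max \<gamma> .
  have xs: "xs \<in> C" "\<And>y. y \<in> C \<Longrightarrow> f xs \<le> f y"
    using assms(10) by (auto simp: is_arg_min_linorder)
  define M where "M = L * \<delta>\<^sup>2 / 2"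
  define q where "q = 1 / (1 - \<theta>)"
  have M: "0 \<le> M" using L_pos by (simp add: M_def)
  \<comment> \<open>The bound \<open>\<theta> \<le> 1/2\<close> becomes \<open>q \<le> 2\<close>,
    which matches the quadratic decay in the recursion.\<close>
  have q: "1 \<le> q" "q \<le> 2" "1 / q = 1 - \<theta>"
    using assms(9) by (auto simp: q_def field_simps)
  have T: "0 < T" and \<eta>0: "\<eta> 0 = 1" using t assms(13) by auto
  have A: "0 < \<omega> / \<mu>" using assms(5,8) by simp
  have "h t \<le> rate_bound M (\<omega> / \<mu>) q (4 / (real (l t) + 2))"
  proof (rule open_loop_recursion[where T = T and h = h and l = l, OF q(1,2) M A])
    show "0 \<le> h s" if "s \<le> T" for s
      using xs(2)[OF x_in[OF state_ok[OF that]]] by (simp add: assms(15))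
    show "h 1 \<le> M"
      using first_iterate[OF T \<eta>0 xs(1)] by (simp add: assms(2,15) M_def)
    show "l 1 = 1" by (rule l_1[OF T])
    show "l (Suc s) = l s \<and> h (Suc s) \<le> h s \<or>
      l (Suc s) = Suc (l s) \<and>
        (\<omega> / \<mu> * h s powr (1 / q) \<le> 4 * (4 / (real (l s) + 4)) * M \<and>
           h (Suc s) \<le> h s + (4 / (real (l s) + 4))\<^sup>2 * M \<or>
         h (Suc s) \<le> (1 - 4 / (real (l s) + 4) / 2) * h s)" if "s < T" for s
    proof -
      have "0 < pyramidal_width C" using assms(4,5) by simp
      from iteration_cases[OF that xs this assms(8,12)] show ?thesis
        by (simp only: q(3) M_def assms(2,4,13,15) of_int_of_nat_eq)
    qed
  qed (use t in auto)
  also have "\<dots> \<le> rate_bound M (\<omega> / \<mu>) q (\<eta> \<lceil>real t / 2 - 2\<rceil>)"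
  proof (rule rate_bound_mono)
    \<comment> \<open>At least half of the steps made progress, so the index in the claim is at most
      \<open>l t - 2\<close> and its step size at least \<open>4 / (real (l t) + 2)\<close>.\<close>
    have "t \<le> 2 * l t" using t by (intro half_le_progress) simp
    then have "\<lceil>real t / 2 - 2\<rceil> \<le> int (l t) - 2"
      by (simp add: ceiling_le_iff)
    then have "real_of_int \<lceil>real t / 2 - 2\<rceil> \<le> real (l t) - 2"
      by linarith
    \<comment> \<open>The index equals -1 for \<open>t = 1\<close> and \<open>t = 2\<close>; the
      denominator of the step size stays positive.\<close>
    moreover have "0 < real_of_int \<lceil>real t / 2 - 2\<rceil> + 4"
      using le_of_int_ceiling[of "real t / 2 - 2"] by linarith
    ultimately show "4 / (real (l t) + 2) \<le> \<eta> \<lceil>real t / 2 - 2\<rceil>"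
      unfolding assms(13) by (intro divide_left_mono mult_pos_pos) linarith+
  qed (use M A q in auto)
  also have "4 * e * M / (\<omega> / \<mu>) = e * 2 * \<mu> * L * \<delta>\<^sup>2 / \<omega>" for e
    by (simp add: M_def)
  then have "rate_bound M (\<omega> / \<mu>) q (\<eta> \<lceil>real t / 2 - 2\<rceil>) =
    max (\<eta> \<lceil>real t / 2 - 2\<rceil> powr (1 / (1 - \<theta>)) * (L * \<delta>\<^sup>2 / 2))
      ((\<eta> \<lceil>real t / 2 - 2\<rceil> * 2 * \<mu> * L * \<delta>\<^sup>2 / \<omega>) powr (1 / (1 - \<theta>))
        + (\<eta> \<lceil>real t / 2 - 2\<rceil>)\<^sup>2 * (L * \<delta>\<^sup>2 / 2))"
    by (simp only: rate_bound_def q_def) (simp only: M_def)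
  finally show "h t \<le> max
      (\<eta> \<lceil>real t / 2 - 2\<rceil> powr (1 / (1 - \<theta>)) * (L * \<delta>\<^sup>2 / 2))
      ((\<eta> \<lceil>real t / 2 - 2\<rceil> * 2 * \<mu> * L * \<delta>\<^sup>2 / \<omega>) powr (1 / (1 - \<theta>))
        + (\<eta> \<lceil>real t / 2 - 2\<rceil>)\<^sup>2 * (L * \<delta>\<^sup>2 / 2))" .
qed

end
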